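(* Consider the $T\overline T$ flow of the BMS free fermion: let $\mathcal L^{(n)}$, $T^{\mu(n)}_{\ \nu}$ be defined from the seed Lagrangian $\mathcal L^{(0)}=\psi_1\partial_x\psi_1-\frac12\psi_2\partial_y\psi_1-\frac12\psi_1\partial_y\psi_2$ and the seed (on-shell) stress tensor $T^{\mu(0)}_{\ \nu}$ given in the context by the recursion $$\mathcal L^{(n+1)}=\frac12\sum_{i=0}^n\binom ni\left(T^{\mu(i)}_{\ \mu}T^{\nu(n-i)}_{\ \nu}-T^{\mu(i)}_{\ \nu}T^{\nu(n-i)}_{\ \mu}\right)\quad(n\ge0),$$ $$T^{\mu(n)}_{\ \nu}=\frac{\partial\mathcal L^{(n)}}{\partial(\partial_\mu\psi_a)}\partial_\nu\psi_a-\delta^\mu_{\ \nu}\mathcal L^{(n)}\quad(n\ge1).$$ Then $\mathcal L^{(n)}=0$ and $T^{\mu(n)}_{\ \nu}=0$ for all $n\ge1$; consequently the deformed Lagrangian $\mathcal L^{[\lambda]}=\sum_{n\ge0}\frac{\lambda^n}{n!}\mathcal L^{(n)}$ equals $\mathcal L^{(0)}$.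
   Context: $\psi_1,\psi_2$ are anticommuting (Grassmann) fields; $\psi_a$ and their derivatives $\partial_x\psi_a,\partial_y\psi_a$ ($a=1,2$) are odd generators of a Grassmann algebra, so each squares to zero and they anticommute pairwise. Indices $\mu,\nu\in\{x,y\}$ and $a\in\{1,2\}$; repeated indices are summed. Derivatives $\partial/\partial(\partial_\mu\psi_a)$ are right derivatives (the differentiated factor is moved to the right and removed). The seed stress tensor, obtained by using the equations of motion $\partial_y\psi_1=0$, $2\partial_x\psi_1=\partial_y\psi_2$, has components $$T^{y(0)}_{\ y}=M,\quad T^{x(0)}_{\ x}=-M,\quad T^{y(0)}_{\ x}=T,\quad T^{x(0)}_{\ y}=0,\qquad M=-\psi_1\partial_x\psi_1,\quad T=-\tfrac12\psi_2\partial_x\psi_1-\tfrac12\psi_1\partial_x\psi_2.$$ Apart from this choice of $T^{\mu(0)}_{\ \nu}$ the equations of motion are not imposed. *)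

theory Defs
  imports "HOL-Analysis.Analysis"
begin

section \<open>The Grassmann algebra on a finite ordered set of odd generators\<close>

text \<open>
  An element is its family of coefficients in the monomial basis: the coefficient at
  \<open>S\<close> belongs to the product of the generators in \<open>S\<close>, taken in increasing order.
\<close>

typedef ('g, 'k) grassmann = "UNIV :: ('g set \<Rightarrow> 'k) set"
  morphisms gcoeff Grassmann ..

lemma gcoeff_Grassmann [simp]: "gcoeff (Grassmann f) = f"
  by (simp add: Grassmann_inverse)

lemma grassmann_eqI: "(\<And>S. gcoeff u S = gcoeff v S) \<Longrightarrow> u = v"
  by (metis ext gcoeff_inject)

text \<open>
  For disjoint \<open>A\<close> and \<open>B\<close>, the sign picked up when the increasing monomial on \<open>A\<close>
  times the increasing monomial on \<open>B\<close> is sorted into the increasing monomial on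
  \<open>A \<union> B\<close>: one factor \<open>-1\<close> per inversion.
\<close>

definition gsign :: "'g::linorder set \<Rightarrow> 'g set \<Rightarrow> 'k::comm_ring_1" where
  "gsign A B = (-1) ^ card {(a, b). a \<in> A \<and> b \<in> B \<and> b < a}"

instantiation grassmann :: (type, comm_ring_1) ab_group_add
begin
definition "0 = Grassmann (\<lambda>S. 0)"
definition "u + v = Grassmann (\<lambda>S. gcoeff u S + gcoeff v S)"
definition "u - v = Grassmann (\<lambda>S. gcoeff u S - gcoeff v S)"
definition "- u = Grassmann (\<lambda>S. - gcoeff u S)"
instance
  by standard
    (auto intro!: grassmann_eqI simp: zero_grassmann_def plus_grassmann_def
      minus_grassmann_def uminus_grassmann_def)
end

lemma gcoeff_linear [simp]:
  "gcoeff 0 S = 0" "gcoeff (u + v) S = gcoeff u S + gcoeff v S"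
  "gcoeff (u - v) S = gcoeff u S - gcoeff v S" "gcoeff (- u) S = - gcoeff u S"
  by (simp_all add: zero_grassmann_def plus_grassmann_def minus_grassmann_def
      uminus_grassmann_def)

lemma gsign_Un_left:
  fixes A B C :: "'g::{finite, linorder} set"
  assumes "A \<inter> B = {}"
  shows "gsign (A \<union> B) C = (gsign A C * gsign B C :: 'k::comm_ring_1)"
proof -
  have eq: "{(a, b). a \<in> A \<union> B \<and> b \<in> C \<and> b < a} =
      {(a, b). a \<in> A \<and> b \<in> C \<and> b < a} \<union> {(a, b). a \<in> B \<and> b \<in> C \<and> b < a}"
    by auto
  show ?thesis
    unfolding gsign_def eq using assms
    by (subst card_Un_disjoint) (auto simp: power_add)
qed

lemma gsign_Un_right:
  fixes A B C :: "'g::{finite, linorder} set"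
  assumes "B \<inter> C = {}"
  shows "gsign A (B \<union> C) = (gsign A B * gsign A C :: 'k::comm_ring_1)"
proof -
  have eq: "{(a, b). a \<in> A \<and> b \<in> B \<union> C \<and> b < a} =
      {(a, b). a \<in> A \<and> b \<in> B \<and> b < a} \<union> {(a, b). a \<in> A \<and> b \<in> C \<and> b < a}"
    by auto
  show ?thesis
    unfolding gsign_def eq using assms
    by (subst card_Un_disjoint) (auto simp: power_add)
qed

lemma gsign_empty [simp]: "gsign {} B = 1" "gsign A {} = 1"
  by (simp_all add: gsign_def)

lemma gsign_square [simp]: "gsign A B * gsign A B = (1 :: 'k::comm_ring_1)"
  by (simp add: gsign_def flip: power_add)

lemma gsign_singletons:
  "gsign {g} {h} = (if h < g then -1 else 1 :: 'k::comm_ring_1)"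
proof -
  have "{(a, b). a \<in> {g} \<and> b \<in> {h} \<and> b < a} = (if h < g then {(g, h)} else {})"
    by auto
  then show ?thesis by (simp add: gsign_def)
qed

instantiation grassmann :: ("{finite, linorder}", comm_ring_1) ring_1
begin

definition "1 = Grassmann (\<lambda>S. if S = {} then 1 else 0)"

definition
  "u * v = Grassmann (\<lambda>S. \<Sum>A\<in>Pow S. gsign A (S - A) * gcoeff u A * gcoeff v (S - A))"

lemma gcoeff_one: "gcoeff 1 S = (if S = {} then 1 else 0)"
  by (simp add: one_grassmann_def)

lemma gcoeff_times:
  "gcoeff (u * v) S = (\<Sum>A\<in>Pow S. gsign A (S - A) * gcoeff u A * gcoeff v (S - A))"
  by (simp add: times_grassmann_def)

instance
proof
  fix u v w :: "('a, 'b) grassmann"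
  show "u * v * w = u * (v * w)"
  proof (rule grassmann_eqI)
    fix S :: "'a set"
    let ?f = "\<lambda>B C. gsign B (S - B) * gsign C (S - B - C) *
      (gcoeff u B * (gcoeff v C * gcoeff w (S - B - C))) :: 'b"
    have sgn: "gsign A (S - A) * gsign B (A - B) =
        (gsign B (S - B) * gsign (A - B) (S - B - (A - B)) :: 'b)"
      if "A \<subseteq> S" "B \<subseteq> A" for A B
    proof -
      have "gsign A (S - A) = (gsign B (S - A) * gsign (A - B) (S - A) :: 'b)"
        using gsign_Un_left[of B "A - B" "S - A"] that by (simp add: Un_absorb1)
      moreover have "gsign B (S - B) = (gsign B (A - B) * gsign B (S - A) :: 'b)"
      proof -
        have "S - B = (A - B) \<union> (S - A)" using that by auto
        then show ?thesis
          using gsign_Un_right[of "A - B" "S - A" B] by auto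
      qed
      moreover have "S - B - (A - B) = S - A" using that by auto
      ultimately show ?thesis by (simp add: mult_ac)
    qed
    have "gcoeff (u * v * w) S =
        (\<Sum>A\<in>Pow S. \<Sum>B\<in>Pow A. gsign A (S - A) * gsign B (A - B) *
          (gcoeff u B * (gcoeff v (A - B) * gcoeff w (S - A))))"
      by (simp add: gcoeff_times sum_distrib_left sum_distrib_right mult_ac)
    also have "\<dots> = (\<Sum>(A, B)\<in>Sigma (Pow S) Pow. gsign A (S - A) * gsign B (A - B) *
          (gcoeff u B * (gcoeff v (A - B) * gcoeff w (S - A))))"
      by (rule sum.Sigma) auto
    also have "\<dots> = (\<Sum>(B, C)\<in>Sigma (Pow S) (\<lambda>B. Pow (S - B)). ?f B C)"
    proof (rule sum.reindex_bij_witness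
        [where i = "\<lambda>(B, C). (B \<union> C, B)" and j = "\<lambda>(A, B). (B, A - B)"],
        goal_cases)
      case (5 p)
      then obtain A B where p: "p = (A, B)" "A \<subseteq> S" "B \<subseteq> A" by auto
      moreover from p have "S - B - (A - B) = S - A" by auto
      ultimately show ?case using sgn[of A B] by simp
    qed auto
    also have "\<dots> = (\<Sum>B\<in>Pow S. \<Sum>C\<in>Pow (S - B). ?f B C)"
      by (rule sum.Sigma[symmetric]) auto
    also have "\<dots> = gcoeff (u * (v * w)) S"
      by (simp add: gcoeff_times sum_distrib_left sum_distrib_right mult_ac)
    finally show "gcoeff (u * v * w) S = gcoeff (u * (v * w)) S" .
  qed
  show "1 * u = u"
  proof (rule grassmann_eqI)
    fix S :: "'a set"
    have "gcoeff (1 * u) S = (\<Sum>A\<in>Pow S. if A = {} then gcoeff u S else 0)"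
      unfolding gcoeff_times gcoeff_one by (intro sum.cong) auto
    then show "gcoeff (1 * u) S = gcoeff u S" by simp
  qed
  show "u * 1 = u"
  proof (rule grassmann_eqI)
    fix S :: "'a set"
    have "gcoeff (u * 1) S = (\<Sum>A\<in>Pow S. if A = S then gcoeff u S else 0)"
      unfolding gcoeff_times gcoeff_one by (intro sum.cong) auto
    then show "gcoeff (u * 1) S = gcoeff u S" by simp
  qed
  show "(u + v) * w = u * w + v * w" "u * (v + w) = u * v + u * w"
    by (auto intro!: grassmann_eqI simp: gcoeff_times algebra_simps sum.distrib)
  have "gcoeff (0 :: ('a, 'b) grassmann) {} \<noteq> gcoeff (1 :: ('a, 'b) grassmann) {}"
    by (simp add: gcoeff_one)
  then show "(0 :: ('a, 'b) grassmann) \<noteq> 1" by metis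
qed

end

definition gscale :: "'k::comm_ring_1 \<Rightarrow> ('g, 'k) grassmann \<Rightarrow> ('g, 'k) grassmann"
    (infixr "*\<^sub>G" 75) where
  "c *\<^sub>G u = Grassmann (\<lambda>S. c * gcoeff u S)"

lemma gcoeff_gscale [simp]: "gcoeff (c *\<^sub>G u) S = c * gcoeff u S"
  by (simp add: gscale_def)

lemma gscale_mult:
  fixes u v :: "('g::{finite, linorder}, 'k::comm_ring_1) grassmann"
  shows "(c *\<^sub>G u) * v = c *\<^sub>G (u * v)" "u * (c *\<^sub>G v) = c *\<^sub>G (u * v)"
  by (auto intro!: grassmann_eqI simp: gcoeff_times sum_distrib_left mult_ac)

definition gen :: "'g \<Rightarrow> ('g, 'k::comm_ring_1) grassmann" where
  "gen g = Grassmann (\<lambda>S. if S = {g} then 1 else 0)"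

lemma gcoeff_times_gen:
  fixes u :: "('g::{finite, linorder}, 'k::comm_ring_1) grassmann"
  shows "gcoeff (u * gen h) S =
    (if h \<in> S then gsign (S - {h}) {h} * gcoeff u (S - {h}) else 0)"
proof -
  have "gcoeff (u * gen h) S =
      (\<Sum>A\<in>Pow S. if A = S - {h} then
         (if h \<in> S then gsign (S - {h}) {h} * gcoeff u (S - {h}) else 0) else 0)"
    unfolding gcoeff_times gen_def
  proof (intro sum.cong refl)
    fix A assume "A \<in> Pow S"
    then have "S - A = {h} \<longleftrightarrow> h \<in> S \<and> A = S - {h}" by auto
    moreover have "S - (S - {h}) = {h}" if "h \<in> S" using that by auto
    ultimately show "gsign A (S - A) * gcoeff u A *
        gcoeff (Grassmann (\<lambda>S. if S = {h} then 1 else 0)) (S - A) =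
        (if A = S - {h} then
         (if h \<in> S then gsign (S - {h}) {h} * gcoeff u (S - {h}) else 0) else 0)"
      by auto
  qed
  then show ?thesis by simp
qed

lemma gen_anticommute:
  "gen g * gen h = - (gen h * gen g :: ('g::{finite, linorder}, 'k::comm_ring_1) grassmann)"
proof (rule grassmann_eqI)
  fix S :: "'g set"
  have *: "h \<in> S \<and> S - {h} = {g} \<longleftrightarrow> g \<in> S \<and> S - {g} = {h}" by auto
  show "gcoeff (gen g * gen h) S = (gcoeff (- (gen h * gen g)) S :: 'k)"
  proof (cases "g = h")
    case True
    then show ?thesis
      by (simp add: gcoeff_times_gen) (auto simp: gen_def)
  next
    case False
    then show ?thesis
      using * by (simp add: gcoeff_times_gen) (auto simp: gen_def gsign_singletons)
  qed
qed

lemma gen_square: "gen g * gen g = (0 :: ('g::{finite, linorder}, 'k::comm_ring_1) grassmann)"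
  by (rule grassmann_eqI, simp add: gcoeff_times_gen) (auto simp: gen_def)


subsection \<open>Right derivatives\<close>

text \<open>
  Moving \<open>g\<close> to the right end of the increasing monomial on \<open>insert g S\<close> costs the sign
  \<open>gsign S {g}\<close>; \<open>rderiv_gen_mult\<close> below is the resulting graded Leibniz rule.
\<close>

definition rderiv ::
    "'g::linorder \<Rightarrow> ('g, 'k::comm_ring_1) grassmann \<Rightarrow> ('g, 'k) grassmann" where
  "rderiv g u = Grassmann (\<lambda>S. if g \<in> S then 0 else gsign S {g} * gcoeff u (insert g S))"

lemma gcoeff_rderiv:
  "gcoeff (rderiv g u) S = (if g \<in> S then 0 else gsign S {g} * gcoeff u (insert g S))"
  by (simp add: rderiv_def)

lemma rderiv_linear:
  "rderiv g 0 = 0" "rderiv g (u + v) = rderiv g u + rderiv g v"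
  "rderiv g (u - v) = rderiv g u - rderiv g v" "rderiv g (- u) = - rderiv g u"
  "rderiv g (c *\<^sub>G u) = c *\<^sub>G rderiv g u"
  by (auto intro!: grassmann_eqI simp: gcoeff_rderiv algebra_simps)

lemma rderiv_one:
  "rderiv g (1 :: ('g::{finite, linorder}, 'k::comm_ring_1) grassmann) = 0"
  by (auto intro!: grassmann_eqI simp: gcoeff_rderiv gcoeff_one)

lemma rderiv_gen_mult:
  fixes u :: "('g::{finite, linorder}, 'k::comm_ring_1) grassmann"
  shows "rderiv g (u * gen h) = (if g = h then u else 0) - rderiv g u * gen h"
proof (rule grassmann_eqI)
  fix S :: "'g set"
  show "gcoeff (rderiv g (u * gen h)) S =
      gcoeff ((if g = h then u else 0) - rderiv g u * gen h) S"
  proof (cases "g = h")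
    case True
    have "gsign R {h} * (gsign R {h} * c) = (c :: 'k)" for R c
      by (simp flip: mult.assoc)
    with True show ?thesis
      by (auto simp: gcoeff_rderiv gcoeff_times_gen insert_absorb)
  next
    case False
    show ?thesis
    proof (cases "h \<in> S \<and> g \<notin> S")
      case True
      define R where "R = S - {h}"
      have S: "S = R \<union> {h}" "R \<inter> {h} = {}" using True by (auto simp: R_def)
      have gR: "insert g S - {h} = R \<union> {g}" "R \<inter> {g} = {}"
        using True False by (auto simp: R_def)
      have ins: "insert g (S - {h}) = R \<union> {g}" by (auto simp: R_def)
      have "gsign S {g} = (gsign R {g} * gsign {h} {g} :: 'k)"
        unfolding S(1) by (rule gsign_Un_left[OF S(2)])
      moreover have "gsign (R \<union> {g}) {h} = (gsign R {h} * gsign {g} {h} :: 'k)"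
        by (rule gsign_Un_left[OF gR(2)])
      moreover have "gsign {h} {g} * gsign {g} {h} = (-1 :: 'k)"
        using False by (auto simp: gsign_singletons)
      ultimately have "gsign S {g} * gsign (R \<union> {g}) {h} =
          (- (gsign R {h} * gsign R {g}) :: 'k)"
        by (metis (no_types, opaque_lifting) mult.assoc mult.commute mult_minus1)
      then show ?thesis
        using True False gR(2)
        by (simp add: gcoeff_rderiv gcoeff_times_gen gR(1) ins flip: mult.assoc R_def)
    qed (use False in \<open>auto simp: gcoeff_rderiv gcoeff_times_gen\<close>)
  qed
qed


subsection \<open>Coefficientwise topology\<close>

text \<open>The topology used for the infinite series in the deformation parameter.\<close>

instantiation grassmann :: (type, topological_space) topological_space
begin
definition open_grassmann :: "('a, 'b) grassmann set \<Rightarrow> bool" where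
  "open U \<longleftrightarrow> open (gcoeff ` U)"
instance
proof
  have inj: "inj gcoeff" by (simp add: inj_on_def gcoeff_inject)
  have surj: "range (gcoeff :: ('a, 'b) grassmann \<Rightarrow> _) = UNIV"
    by (metis gcoeff_Grassmann surjI)
  show "open (UNIV :: ('a, 'b) grassmann set)"
    by (simp add: open_grassmann_def surj)
  show "open (U \<inter> V)" if "open U" "open V" for U V :: "('a, 'b) grassmann set"
    using that by (simp add: open_grassmann_def image_Int[OF inj] open_Int)
  show "open (\<Union>K)" if "\<forall>U\<in>K. open U" for K :: "('a, 'b) grassmann set set"
    using that by (auto simp: open_grassmann_def image_Union)
qed
end

instance grassmann :: (type, t2_space) t2_space
proof
  fix u v :: "('a, 'b) grassmann"
  assume "u \<noteq> v"
  then have "gcoeff u \<noteq> gcoeff v" by (simp add: gcoeff_inject)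
  then obtain S where "gcoeff u S \<noteq> gcoeff v S" by blast
  then obtain U V where UV: "open U" "open V" "gcoeff u S \<in> U" "gcoeff v S \<in> V" "U \<inter> V = {}"
    by (meson hausdorff)
  define P where "P W = {w :: ('a, 'b) grassmann. gcoeff w S \<in> W}" for W
  have "open (P W)" if "open W" for W
  proof -
    have "gcoeff ` P W = (\<lambda>f. f S) -` W"
      unfolding P_def by (auto simp: image_iff) (metis gcoeff_Grassmann)
    moreover have "open ((\<lambda>f :: 'a set \<Rightarrow> 'b. f S) -` W)"
      by (rule open_vimage[OF that]) (rule continuous_on_product_coordinates)
    ultimately show ?thesis by (simp add: open_grassmann_def)
  qed
  with UV have "open (P U)" "open (P V)" by auto
  moreover have "u \<in> P U" "v \<in> P V" "P U \<inter> P V = {}" using UV by (auto simp: P_def)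
  ultimately show "\<exists>U V. open U \<and> open V \<and> u \<in> U \<and> v \<in> V \<and> U \<inter> V = {}" by blast
qed


section \<open>The BMS free fermion\<close>

datatype coord = X | Y
datatype species = I1 | I2

text \<open>The odd generators: the fields and their first derivatives.\<close>

datatype jet = Field species | Deriv coord species

lemma UNIV_coord: "UNIV = {X, Y}"
  by (rule UNIV_eq_I) (case_tac x, simp_all)

lemma UNIV_species: "UNIV = {I1, I2}"
  by (rule UNIV_eq_I) (case_tac x, simp_all)

instance coord :: finite
  by standard (simp only: UNIV_coord finite_insert finite.emptyI)

instance species :: finite
  by standard (simp only: UNIV_species finite_insert finite.emptyI)

instance jet :: finite
proof
  have "g \<in> range Field \<union> range (\<lambda>(\<mu>, a). Deriv \<mu> a)" for g
    by (cases g) auto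
  then have "(UNIV :: jet set) = range Field \<union> range (\<lambda>(\<mu>, a). Deriv \<mu> a)"
    by (rule UNIV_eq_I)
  moreover have "finite (range Field \<union> range (\<lambda>(\<mu>, a). Deriv \<mu> a))"
    by (intro finite_UnI finite_imageI finite)
  ultimately show "finite (UNIV :: jet set)" by argo
qed

text \<open>An arbitrary order, needed only to fix the monomial basis.\<close>

fun jet_rank :: "jet \<Rightarrow> nat" where
  "jet_rank (Field I1) = 0"
| "jet_rank (Field I2) = 1"
| "jet_rank (Deriv X I1) = 2"
| "jet_rank (Deriv X I2) = 3"
| "jet_rank (Deriv Y I1) = 4"
| "jet_rank (Deriv Y I2) = 5"

lemma jet_rank_inject: "jet_rank g = jet_rank h \<Longrightarrow> g = h"
  by (cases g rule: jet_rank.cases; cases h rule: jet_rank.cases; simp)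

instantiation jet :: linorder
begin
definition "g \<le> h \<longleftrightarrow> jet_rank g \<le> jet_rank h"
definition "g < h \<longleftrightarrow> jet_rank g < jet_rank h"
instance
  by standard (auto simp: less_eq_jet_def less_jet_def intro: jet_rank_inject)
end

definition \<psi> :: "species \<Rightarrow> (jet, 'k::comm_ring_1) grassmann" where
  "\<psi> a = gen (Field a)"

definition D\<psi> :: "coord \<Rightarrow> species \<Rightarrow> (jet, 'k::comm_ring_1) grassmann" where
  "D\<psi> \<mu> a = gen (Deriv \<mu> a)"

definition seed_lagrangian :: "(jet, 'k::field) grassmann" where
  "seed_lagrangian = \<psi> I1 * D\<psi> X I1
     - (1/2) *\<^sub>G (\<psi> I2 * D\<psi> Y I1) - (1/2) *\<^sub>G (\<psi> I1 * D\<psi> Y I2)"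

definition seed_M :: "(jet, 'k::field) grassmann" where
  "seed_M = - (\<psi> I1 * D\<psi> X I1)"

definition seed_T :: "(jet, 'k::field) grassmann" where
  "seed_T = - ((1/2) *\<^sub>G (\<psi> I2 * D\<psi> X I1)) - (1/2) *\<^sub>G (\<psi> I1 * D\<psi> X I2)"

text \<open>
  In every stress tensor the first index is the upper one, \<open>\<mu>\<close>, and the second the
  lower one, \<open>\<nu>\<close>.
\<close>

fun seed_stress :: "coord \<Rightarrow> coord \<Rightarrow> (jet, 'k::field) grassmann" where
  "seed_stress Y Y = seed_M"
| "seed_stress X X = - seed_M"
| "seed_stress Y X = seed_T"
| "seed_stress X Y = 0"

definition canonical_stress ::
    "(jet, 'k::field) grassmann \<Rightarrow> coord \<Rightarrow> coord \<Rightarrow> (jet, 'k) grassmann" where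
  "canonical_stress L \<mu> \<nu> =
     (\<Sum>a\<in>UNIV. rderiv (Deriv \<mu> a) L * D\<psi> \<nu> a) - (if \<mu> = \<nu> then L else 0)"

text \<open>
  The seed stress tensor is the canonical one of the seed Lagrangian with the terms that
  vanish by the equations of motion dropped: \<open>\<partial>\<^sub>y\<psi>\<^sub>1\<close> is replaced by \<open>0\<close> and
  \<open>\<partial>\<^sub>y\<psi>\<^sub>2\<close> by \<open>2 \<partial>\<^sub>x\<psi>\<^sub>1\<close> in the following.
\<close>

lemma canonical_stress_seed:
  fixes L :: "(jet, 'k::field_char_0) grassmann"
  defines "L \<equiv> seed_lagrangian"
  shows "canonical_stress L X X = \<psi> I1 * D\<psi> X I1 - L"
    and "canonical_stress L X Y = \<psi> I1 * D\<psi> Y I1"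
    and "canonical_stress L Y X =
      - ((1/2) *\<^sub>G (\<psi> I2 * D\<psi> X I1)) - (1/2) *\<^sub>G (\<psi> I1 * D\<psi> X I2)"
    and "canonical_stress L Y Y =
      - ((1/2) *\<^sub>G (\<psi> I2 * D\<psi> Y I1)) - (1/2) *\<^sub>G (\<psi> I1 * D\<psi> Y I2) - L"
proof -
  have fld: "rderiv (Deriv \<mu> a) (gen (Field b)) = (0 :: (jet, 'k) grassmann)" for \<mu> a b
    using rderiv_gen_mult[of "Deriv \<mu> a" 1 "Field b"] by (simp add: rderiv_one)
  note d = canonical_stress_def L_def seed_lagrangian_def \<psi>_def D\<psi>_def UNIV_species
    rderiv_linear rderiv_gen_mult fld gscale_mult
  have z: "c *\<^sub>G 0 = (0 :: (jet, 'k) grassmann)" for c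
    by (rule grassmann_eqI) simp
  show "canonical_stress L X X = \<psi> I1 * D\<psi> X I1 - L"
    and "canonical_stress L X Y = \<psi> I1 * D\<psi> Y I1"
    and "canonical_stress L Y X =
      - ((1/2) *\<^sub>G (\<psi> I2 * D\<psi> X I1)) - (1/2) *\<^sub>G (\<psi> I1 * D\<psi> X I2)"
    and "canonical_stress L Y Y =
      - ((1/2) *\<^sub>G (\<psi> I2 * D\<psi> Y I1)) - (1/2) *\<^sub>G (\<psi> I1 * D\<psi> Y I2) - L"
    by (simp_all add: d z left_diff_distrib)
qed

function flow_lagrangian :: "nat \<Rightarrow> (jet, 'k::field_char_0) grassmann"
  and flow_stress :: "nat \<Rightarrow> coord \<Rightarrow> coord \<Rightarrow> (jet, 'k) grassmann" where
  "flow_lagrangian 0 = seed_lagrangian"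
| "flow_lagrangian (Suc n) = (1/2) *\<^sub>G (\<Sum>i\<le>n. of_nat (n choose i) *\<^sub>G
     ((\<Sum>\<mu>\<in>UNIV. flow_stress i \<mu> \<mu>) * (\<Sum>\<nu>\<in>UNIV. flow_stress (n - i) \<nu> \<nu>)
      - (\<Sum>\<mu>\<in>UNIV. \<Sum>\<nu>\<in>UNIV. flow_stress i \<mu> \<nu> * flow_stress (n - i) \<nu> \<mu>)))"
| "flow_stress 0 = seed_stress"
| "flow_stress (Suc n) = canonical_stress (flow_lagrangian (Suc n))"
  by pat_completeness auto
termination
  by (relation "Wellfounded.measure (case_sum (\<lambda>n. 2 * n) (\<lambda>n. 2 * n + 1))") auto

definition deformed_lagrangian ::
    "'k::{real_normed_field} \<Rightarrow> (jet, 'k) grassmann" where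
  "deformed_lagrangian l = (\<Sum>n. (l ^ n / fact n) *\<^sub>G flow_lagrangian n)"

end

theory Submission
  imports Defs
begin

text \<open>The seed stress tensor is traceless, and the trace of its square is
  \<open>2 * seed_M * seed_M\<close>, which vanishes because \<open>seed_M\<close> is a product of
  odd generators (\<open>flow_lagrangian_one\<close>). So the flow stops at first order. The
  canonical stress of the zero Lagrangian is zero, and at each later order every quadratic term
  contains a stress tensor of positive order, hence a zero factor
  (\<open>flow_vanishes\<close>).\<close>

lemma gscale_one [simp]: "1 *\<^sub>G u = u"
  by (rule grassmann_eqI) simp

lemma gscale_zero [simp]: "c *\<^sub>G 0 = 0"
  by (rule grassmann_eqI) simp

lemma canonical_stress_zero [simp]:
  "canonical_stress 0 = (\<lambda>\<mu> \<nu>. 0 :: (jet, 'k::field) grassmann)"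
  by (intro ext) (simp add: canonical_stress_def rderiv_linear)

text \<open>Swapping the two inner factors costs a sign and brings equal generators together, whose
  squares vanish.\<close>

lemma gen_mult_gen_square:
  "(gen g * gen h) * (gen g * gen h) = (0 :: ('g::{finite, linorder}, 'k::comm_ring_1) grassmann)"
proof -
  have "(gen g * gen h) * (gen g * gen h) = gen g * ((gen h * gen g) * gen h :: ('g, 'k) grassmann)"
    by (simp add: mult.assoc)
  also have "\<dots> = - ((gen g * gen g) * (gen h * gen h))"
    by (subst gen_anticommute[of h g]) (simp add: mult.assoc)
  finally show ?thesis
    by (simp add: gen_square)
qed

text \<open>The only order where both factors are seeds: \<open>seed_T\<close> meets only the zero
  component \<open>seed_stress X Y\<close>, so just squares of \<open>seed_M\<close> survive the
  cancelling trace.\<close>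

lemma flow_lagrangian_one: "flow_lagrangian (Suc 0) = (0 :: (jet, 'k::field_char_0) grassmann)"
proof -
  have "seed_M * seed_M = (0 :: (jet, 'k) grassmann)"
    by (simp add: seed_M_def \<psi>_def D\<psi>_def gen_mult_gen_square)
  then show ?thesis
    by (simp add: UNIV_coord)
qed

text \<open>The recursion reaches back to all lower orders, hence strong induction.\<close>

lemma flow_vanishes:
  "flow_lagrangian (Suc n) = (0 :: (jet, 'k::field_char_0) grassmann) \<and>
   flow_stress (Suc n) = (\<lambda>\<mu> \<nu>. 0 :: (jet, 'k) grassmann)"
proof (induction n rule: less_induct)
  case (less n)
  have "flow_lagrangian (Suc n) = (0 :: (jet, 'k) grassmann)"
  proof (cases n)
    case 0
    then show ?thesis by (simp only: flow_lagrangian_one)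
  next
    case (Suc m)
    have stress: "flow_stress j = (\<lambda>\<mu> \<nu>. 0 :: (jet, 'k) grassmann)" if "0 < j" "j \<le> n" for j
      using less.IH[of "j - 1"] that by simp
    \<comment> \<open>The two orders add up to \<open>n > 0\<close>, so at most one factor is a seed.\<close>
    have seed_free: "flow_stress i = (\<lambda>\<mu> \<nu>. 0 :: (jet, 'k) grassmann) \<or>
        flow_stress (n - i) = (\<lambda>\<mu> \<nu>. 0 :: (jet, 'k) grassmann)" if "i \<le> n" for i
      using stress[of i] stress[of "n - i"] that Suc by (cases "i = 0") auto
    have "of_nat (n choose i) *\<^sub>G
        ((\<Sum>\<mu>\<in>UNIV. flow_stress i \<mu> \<mu>) * (\<Sum>\<nu>\<in>UNIV. flow_stress (n - i) \<nu> \<nu>)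
          - (\<Sum>\<mu>\<in>UNIV. \<Sum>\<nu>\<in>UNIV. flow_stress i \<mu> \<nu> * flow_stress (n - i) \<nu> \<mu>))
        = (0 :: (jet, 'k) grassmann)" if "i \<le> n" for i
      using seed_free[OF that] by (elim disjE) simp_all
    then show ?thesis
      by (simp only: flow_lagrangian.simps) simp
  qed
  then show ?case
    by (simp only: flow_stress.simps canonical_stress_zero simp_thms)
qed

theorem mainTheorem6:
  fixes l :: "'k::real_normed_field"
  shows "(\<forall>n\<ge>1. flow_lagrangian n = (0 :: (jet, 'k) grassmann) \<and>
            (\<forall>\<mu> \<nu>. flow_stress n \<mu> \<nu> = (0 :: (jet, 'k) grassmann))) \<and>
         summable (\<lambda>n. (l ^ n / fact n) *\<^sub>G (flow_lagrangian n :: (jet, 'k) grassmann)) \<and>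
         deformed_lagrangian l = (flow_lagrangian 0 :: (jet, 'k) grassmann)"
proof -
  have zero: "flow_lagrangian n = (0 :: (jet, 'k) grassmann)"
    "flow_stress n \<mu> \<nu> = (0 :: (jet, 'k) grassmann)" if "n \<ge> 1" for n \<mu> \<nu>
    using flow_vanishes[where ?'k = 'k and n = "n - 1"] that by auto
  let ?f = "\<lambda>n. (l ^ n / fact n) *\<^sub>G (flow_lagrangian n :: (jet, 'k) grassmann)"
  \<comment> \<open>Only the term of order 0 is nonzero, so convergence and the value of the series
    come together.\<close>
  have "?f sums (\<Sum>n\<in>{0}. ?f n)"
    by (rule sums_finite) (simp_all add: zero del: flow_lagrangian.simps)
  then have "?f sums flow_lagrangian 0"
    by (simp del: flow_lagrangian.simps)
  then show ?thesis
    using zero by (auto simp: deformed_lagrangian_def sums_iff simp del: flow_lagrangian.simps)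
qed

end
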